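(* Let $b,c>0$ and let $ABC$ be a (nondegenerate) triangle in the Lobachevskii (hyperbolic) plane with $AC=b$ and $AB=c$. Put $a=BC$, let $\alpha,\beta,\gamma$ be the angles of $ABC$ opposite the sides $BC$, $AC$, $AB$ respectively, and let $S$ be the area of $ABC$. Then the following conditions are equivalent: (0) $ABC$ has the maximum area among all hyperbolic triangles $ABC$ with the fixed side lengths $AC=b$ and $AB=c$; (1) $\alpha=\beta+\gamma<\frac{\pi}{2}$; (2) the triangle $ABC$ has a circumscribed circle, and its center coincides with the midpoint of the side $BC$; (3) $\sin\frac{S}{2}=\tanh\frac{b}{2}\cdot\tanh\frac{c}{2}$; (4) $\cos\alpha=\tanh\frac{b}{2}\cdot\tanh\frac{c}{2}$; (5) $\sinh^2\frac{a}{2}=\sinh^2\frac{b}{2}+\sinh^2\frac{c}{2}$.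
   Context: The Lobachevskii plane is the hyperbolic plane of constant curvature $-1$, for instance in the Poincaré disc model: points are the interior points of the Euclidean unit disc, lines are the diameters and the circle arcs orthogonal to the boundary circle, angles are Euclidean angles, and a point at Euclidean distance $r$ from the center of the disc is at hyperbolic distance $d$ from it with $r=\tanh\frac{d}{2}$. All lengths, angles, midpoints and circles are hyperbolic. The area ("square") of a triangle with angles $\alpha,\beta,\gamma$ is its defect $S=\pi-\alpha-\beta-\gamma$. *)

theory Defs
  imports "HOL-Analysis.Analysis"
begin

text \<open>The Poincare disc model of the hyperbolic plane of curvature \<open>-1\<close>.\<close>

abbreviation hplane :: "complex set" where
  "hplane \<equiv> ball 0 1"

text \<open>
  In the second case \<open>(norm p)\<^sup>2 = 1 + r\<^sup>2\<close> says, by Pythagoras, that the circle with centre \<open>p\<close>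
  and radius \<open>r\<close> meets the unit circle orthogonally.
\<close>

definition hline :: "complex set \<Rightarrow> bool" where
  "hline L \<longleftrightarrow>
     (\<exists>u. u \<noteq> 0 \<and> L = hplane \<inter> range (\<lambda>t::real. t *\<^sub>R u)) \<or>
     (\<exists>p r. r > 0 \<and> (norm p)\<^sup>2 = 1 + r\<^sup>2 \<and> L = hplane \<inter> sphere p r)"

definition hdist :: "complex \<Rightarrow> complex \<Rightarrow> real" where
  "hdist z w = 2 * artanh (norm (z - w) / norm (1 - cnj z * w))"

definition hsegment :: "complex \<Rightarrow> complex \<Rightarrow> complex set" where
  "hsegment P Q = {X \<in> hplane. hdist P X + hdist X Q = hdist P Q}"

definition hmidpoint :: "complex \<Rightarrow> complex \<Rightarrow> complex \<Rightarrow> bool" where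
  "hmidpoint M P Q \<longleftrightarrow> M \<in> hsegment P Q \<and> hdist P M = hdist M Q"

definition hcircle :: "complex \<Rightarrow> real \<Rightarrow> complex set" where
  "hcircle p r = {X \<in> hplane. hdist p X = r}"

text \<open>
  The Euclidean unit half-tangent at \<open>P\<close> of the arc from \<open>P\<close> to \<open>Q\<close>: the limit of the
  directions of the Euclidean chords from \<open>P\<close> to points of the arc.
  (It exists for distinct \<open>P\<close> and \<open>Q\<close>; see the lemma \<open>hdir_eq\<close> below.)
\<close>

definition hdir :: "complex \<Rightarrow> complex \<Rightarrow> complex" where
  "hdir P Q = Lim (at P within hsegment P Q) (\<lambda>X. sgn (X - P))"

text \<open>\<open>hangle Q P R\<close> is the angle at the vertex \<open>P\<close>.\<close>

definition hangle :: "complex \<Rightarrow> complex \<Rightarrow> complex \<Rightarrow> real" where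
  "hangle Q P R = arccos (hdir P Q \<bullet> hdir P R)"

definition htriangle :: "complex \<Rightarrow> complex \<Rightarrow> complex \<Rightarrow> bool" where
  "htriangle A B C \<longleftrightarrow>
     A \<in> hplane \<and> B \<in> hplane \<and> C \<in> hplane \<and>
     \<not> (\<exists>L. hline L \<and> A \<in> L \<and> B \<in> L \<and> C \<in> L)"

definition harea :: "complex \<Rightarrow> complex \<Rightarrow> complex \<Rightarrow> real" where
  "harea A B C = pi - hangle B A C - hangle A B C - hangle A C B"

definition hcircumscribed :: "complex \<Rightarrow> real \<Rightarrow> complex \<Rightarrow> complex \<Rightarrow> complex \<Rightarrow> bool" where
  "hcircumscribed p r A B C \<longleftrightarrow>
     p \<in> hplane \<and> r > 0 \<and> A \<in> hcircle p r \<and> B \<in> hcircle p r \<and> C \<in> hcircle p r"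

text \<open>
  The following facts confirm that the definitions are the intended ones: \<open>tanh_hdist_0\<close>
  relates hyperbolic and Euclidean distance from the centre, \<open>hsegment_moebius\<close> describes
  the segments, and \<open>hdir_eq\<close> evaluates the limit in the definition of \<open>hdir\<close>.
\<close>

lemma hdist_denom_nz:
  assumes "z \<in> hplane" "w \<in> hplane"
  shows "1 - cnj z * w \<noteq> 0"
proof
  assume "1 - cnj z * w = 0"
  then have "norm (cnj z * w) = 1" by simp
  moreover have "norm z * norm w < 1"
    using assms mult_strict_mono'[of "norm z" 1 "norm w" 1] by simp
  ultimately show False by (simp add: norm_mult)
qed

lemma hdist_norm_identity: "(norm (1 - cnj z * w))\<^sup>2 - (norm (z - w))\<^sup>2 = (1 - (norm z)\<^sup>2) * (1 - (norm w)\<^sup>2)"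
  by (simp add: cmod_power2) (simp add: algebra_simps power2_eq_square)

lemma hdist_ratio_less_1:
  assumes "z \<in> hplane" "w \<in> hplane"
  shows "norm (z - w) / norm (1 - cnj z * w) < 1"
proof -
  have "(1 - (norm z)\<^sup>2) * (1 - (norm w)\<^sup>2) > 0"
    using assms by (simp add: power_less_one_iff abs_square_less_1)
  then have "(norm (z - w))\<^sup>2 < (norm (1 - cnj z * w))\<^sup>2"
    using hdist_norm_identity[of z w] by linarith
  then have "norm (z - w) < norm (1 - cnj z * w)" by (rule power_less_imp_less_base) simp
  then show ?thesis using hdist_denom_nz[OF assms] by (simp add: divide_less_eq)
qed

lemma tanh_artanh: "\<bar>x\<bar> < 1 \<Longrightarrow> tanh (artanh x) = (x::real)"
proof -
  assume x: "\<bar>x\<bar> < 1"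
  then have p: "(1 + x) / (1 - x) > 0" by (simp add: field_simps abs_less_iff)
  have "exp (- (2 * artanh x)) = (1 - x) / (1 + x)"
    using p by (simp add: artanh_def exp_minus)
  then have "tanh (artanh x) = (1 - (1 - x) / (1 + x)) / (1 + (1 - x) / (1 + x))"
    by (simp add: tanh_real_altdef)
  also have "\<dots> = x" using x by (simp add: divide_simps abs_less_iff)
  finally show "tanh (artanh x) = x" .
qed

lemma tanh_hdist:
  assumes "z \<in> hplane" "w \<in> hplane"
  shows "tanh (hdist z w / 2) = norm (z - w) / norm (1 - cnj z * w)"
  unfolding hdist_def using hdist_ratio_less_1[OF assms] by (simp add: tanh_artanh)

definition moebius :: "complex \<Rightarrow> complex \<Rightarrow> complex" where
  "moebius A z = (z - A) / (1 - cnj A * z)"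

lemma norm_moebius: "norm (moebius A z) = norm (A - z) / norm (1 - cnj A * z)"
  by (simp add: moebius_def norm_divide norm_minus_commute)

lemma moebius_ratio:
  assumes "A \<in> hplane" "z \<in> hplane" "w \<in> hplane"
  shows "norm (moebius A z - moebius A w) / norm (1 - cnj (moebius A z) * moebius A w) = norm (z - w) / norm (1 - cnj z * w)"
proof -
  have nz: "1 - cnj A * z \<noteq> 0" "1 - cnj A * w \<noteq> 0" "1 - A * cnj z \<noteq> 0" "1 - cnj A * A \<noteq> 0"
    using hdist_denom_nz[OF assms(1,2)] hdist_denom_nz[OF assms(1,3)] hdist_denom_nz[OF assms(2,1)] hdist_denom_nz[OF assms(1,1)] by (auto simp: mult.commute)
  have 1: "moebius A z - moebius A w = (z - w) * (1 - cnj A * A) / ((1 - cnj A * z) * (1 - cnj A * w))"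
    unfolding moebius_def diff_frac_eq[OF nz(1,2)]
    by (rule arg_cong[where f = "\<lambda>x. x / _"]) (simp add: algebra_simps)
  have 2: "1 - cnj (moebius A z) * moebius A w = (1 - cnj z * w) * (1 - cnj A * A) / ((1 - A * cnj z) * (1 - cnj A * w))"
  proof -
    have "1 - cnj (moebius A z) * moebius A w =
          ((1 - A * cnj z) * (1 - cnj A * w) - (cnj z - cnj A) * (w - A)) / ((1 - A * cnj z) * (1 - cnj A * w))"
      using nz(2,3) by (simp add: moebius_def diff_divide_distrib[of "(1 - A * cnj z) * (1 - cnj A * w)"])
    also have "(1 - A * cnj z) * (1 - cnj A * w) - (cnj z - cnj A) * (w - A) = (1 - cnj z * w) * (1 - cnj A * A)"
      by (simp add: algebra_simps)
    finally show ?thesis .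
  qed
  have 3: "norm (1 - A * cnj z) = norm (1 - cnj A * z)"
    by (metis complex_cnj_cnj complex_cnj_diff complex_cnj_mult complex_cnj_one complex_mod_cnj)
  show ?thesis unfolding 1 2 norm_mult norm_divide 3 using nz by simp
qed

lemma moebius_in: "A \<in> hplane \<Longrightarrow> z \<in> hplane \<Longrightarrow> moebius A z \<in> hplane"
  using hdist_ratio_less_1[of A z] by (simp add: norm_moebius)

lemma moebius_hdist:
  assumes "A \<in> hplane" "z \<in> hplane" "w \<in> hplane"
  shows "hdist (moebius A z) (moebius A w) = hdist z w"
  using moebius_ratio[OF assms] by (simp add: hdist_def)

lemma moebius_self[simp]: "moebius A A = 0" by (simp add: moebius_def)

lemma tanh_hdist_0: "z \<in> hplane \<Longrightarrow> tanh (hdist 0 z / 2) = norm z"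
  by (subst tanh_hdist) auto

lemma hsegment_0_iff:
  assumes "z \<in> hplane" "w \<in> hplane"
  shows "hdist 0 z + hdist z w = hdist 0 w \<longleftrightarrow> z \<in> closed_segment 0 w"
proof -
  let ?m = "norm (z - w) / norm (1 - cnj z * w)"
  have zw: "norm z < 1" "norm w < 1" "norm z * norm w < 1"
    using assms mult_strict_mono'[of "norm z" 1 "norm w" 1] by auto
  have "hdist 0 z + hdist z w = hdist 0 w \<longleftrightarrow> hdist z w / 2 = hdist 0 w / 2 - hdist 0 z / 2" by argo
  also have "\<dots> \<longleftrightarrow> tanh (hdist z w / 2) = tanh (hdist 0 w / 2 - hdist 0 z / 2)"
    by (simp add: tanh_real_strict_mono injD)
  also have "tanh (hdist 0 w / 2 - hdist 0 z / 2) = (norm w - norm z) / (1 - norm w * norm z)"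
    using tanh_add[of "hdist 0 w / 2" "- hdist 0 z / 2"] assms by (simp add: tanh_hdist_0 cosh_real_nonzero)
  also have "tanh (hdist z w / 2) = ?m" using assms by (rule tanh_hdist)
  also have "?m = (norm w - norm z) / (1 - norm w * norm z) \<longleftrightarrow> norm w = norm z + norm (w - z)"
  proof
    assume L: "?m = (norm w - norm z) / (1 - norm w * norm z)"
    have ge: "norm w \<ge> norm z" using L zw
      by (smt (verit) divide_neg_pos divide_nonneg_nonneg mult.commute norm_ge_zero)
    let ?D = "(1 - (norm z)\<^sup>2) * (1 - (norm w)\<^sup>2)"
    have Dp: "?D > 0" using zw by (simp add: abs_square_less_1)
    let ?n = "(norm (1 - cnj z * w))\<^sup>2" and ?k = "(1 - norm w * norm z)\<^sup>2"
    have np: "?n > 0" "?k > 0" using hdist_denom_nz[OF assms] zw by (auto simp: mult.commute)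
    have "(norm (z - w))\<^sup>2 / ?n = (norm w - norm z)\<^sup>2 / ?k"
      using L by (metis power_divide)
    moreover have "(norm (z - w))\<^sup>2 = ?n - ?D" using hdist_norm_identity[of z w] by simp
    moreover have "(norm w - norm z)\<^sup>2 = ?k - ?D" by (simp add: power2_eq_square algebra_simps)
    ultimately have "?D / ?n = ?D / ?k" using np by (simp add: diff_divide_distrib)
    then have e: "?n = ?k" using Dp np by (auto simp: divide_simps)
    then have "(norm (z - w))\<^sup>2 = (norm w - norm z)\<^sup>2"
      using \<open>(norm (z - w))\<^sup>2 = ?n - ?D\<close> \<open>(norm w - norm z)\<^sup>2 = ?k - ?D\<close> by simp
    then show "norm w = norm z + norm (w - z)" using ge
      by (simp add: norm_minus_commute)
  next
    assume R: "norm w = norm z + norm (w - z)"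
    then have r: "norm (z - w) = norm w - norm z" by (simp add: norm_minus_commute)
    have "(norm (1 - cnj z * w))\<^sup>2 = (1 - norm w * norm z)\<^sup>2"
      using hdist_norm_identity[of z w] r by (simp add: power2_eq_square algebra_simps)
    then have "norm (1 - cnj z * w) = 1 - norm w * norm z"
      using zw by (simp add: mult.commute)
    then show "?m = (norm w - norm z) / (1 - norm w * norm z)" using r by simp
  qed
  also have "\<dots> \<longleftrightarrow> z \<in> closed_segment 0 w"
    by (simp add: between_mem_segment[symmetric] between dist_norm norm_minus_commute)
  finally show ?thesis .
qed

lemma hsegment_moebius:
  assumes "P \<in> hplane" "Q \<in> hplane"
  shows "X \<in> hsegment P Q \<longleftrightarrow> X \<in> hplane \<and> moebius P X \<in> closed_segment 0 (moebius P Q)"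
  using hsegment_0_iff[OF moebius_in[of P X] moebius_in[of P Q]] moebius_hdist[of P P X] moebius_hdist[of P X Q] moebius_hdist[of P P Q] assms
  by (auto simp: hsegment_def)

lemma moebius_inverse_diff: "1 + c * w \<noteq> 0 \<Longrightarrow> (w + P) / (1 + c * w) - P = w * (1 - c * P) / (1 + c * w)" for c w P :: complex
  by (simp add: field_simps)
lemma moebius_inverse_denom: "1 + c * w \<noteq> 0 \<Longrightarrow> 1 - c * ((w + P) / (1 + c * w)) = (1 - c * P) / (1 + c * w)" for c w P :: complex
  by (simp add: field_simps)

lemma divide_divide_cancel: "e \<noteq> 0 \<Longrightarrow> f \<noteq> 0 \<Longrightarrow> w * f / e / (f / e) = w" for e f w :: complex
  by (simp add: field_simps)

lemma hdir_eq:
  assumes "P \<in> hplane" "Q \<in> hplane" "P \<noteq> Q"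
  shows "hdir P Q = sgn ((Q - P) / (1 - cnj P * Q))"
proof -
  let ?q = "moebius P Q"
  have P1: "norm P < 1" using assms by simp
  have nn: "1 - cnj P * P = complex_of_real (1 - (norm P)\<^sup>2)"
    by (simp add: complex_norm_square[symmetric] mult.commute)
  have pp: "1 - (norm P)\<^sup>2 > 0" using P1 by (simp add: abs_square_less_1)
  have q0: "?q \<noteq> 0" using assms hdist_denom_nz[of P Q] by (simp add: moebius_def)
  have lim: "((\<lambda>X. sgn ?q * sgn (1 - cnj P * X)) \<longlongrightarrow> sgn ?q * sgn (1 - cnj P * P)) (at P within hsegment P Q)"
    using hdist_denom_nz[OF assms(1,1)] by (intro tendsto_intros) auto
  moreover have "sgn (1 - cnj P * P) = 1"
    unfolding nn using pp by (simp add: sgn_of_real del: of_real_diff)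
  moreover have "\<forall>\<^sub>F X in at P within hsegment P Q. sgn ?q * sgn (1 - cnj P * X) = sgn (X - P)"
    unfolding eventually_at_filter
  proof (intro always_eventually allI impI)
    fix X assume X: "X \<noteq> P" "X \<in> hsegment P Q"
    then have Xh: "X \<in> hplane" and "moebius P X \<in> closed_segment 0 ?q"
      using hsegment_moebius assms by auto
    then obtain s :: real where s: "0 \<le> s" "moebius P X = s *\<^sub>R ?q" by (auto simp: closed_segment_def)
    have d: "1 - cnj P * X \<noteq> 0" using hdist_denom_nz assms Xh by blast
    then have XP: "X - P = s *\<^sub>R (?q * (1 - cnj P * X))"
      using s(2) by (simp add: moebius_def[of P X] divide_simps mult.assoc)
    have "s \<noteq> 0" using XP X by auto
    then have "s > 0" using s by simp
    then show "sgn ?q * sgn (1 - cnj P * X) = sgn (X - P)" unfolding XP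
      by (simp add: sgn_mult sgn_scaleR)
  qed
  ultimately have L: "((\<lambda>X. sgn (X - P)) \<longlongrightarrow> sgn ?q) (at P within hsegment P Q)"
    by (simp add: tendsto_cong)
  let ?X = "\<lambda>t::real. (t *\<^sub>R ?q + P) / (1 + cnj P * (t *\<^sub>R ?q))"
  have Xt: "?X t \<in> hsegment P Q \<and> ?X t \<noteq> P" if t: "0 < t" "t \<le> 1" for t
  proof -
    let ?w = "t *\<^sub>R ?q"
    have wh: "?w \<in> hplane"
    proof -
      have "t * norm ?q \<le> norm ?q" using t by (simp add: mult_left_le_one_le)
      then show ?thesis using moebius_in[OF assms(1,2)] t by simp
    qed
    have m: "?X t = moebius (-P) ?w" by (simp add: moebius_def)
    have Xh: "?X t \<in> hplane" unfolding m using assms(1) wh by (intro moebius_in) auto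
    have d: "1 + cnj P * ?w \<noteq> 0" using hdist_denom_nz[of "-P" ?w] assms wh by simp
    have d2: "1 - cnj P * P \<noteq> 0" using hdist_denom_nz assms by blast
    have n1: "?X t - P = ?w * (1 - cnj P * P) / (1 + cnj P * ?w)"
      using moebius_inverse_diff[OF d] .
    have n2: "1 - cnj P * ?X t = (1 - cnj P * P) / (1 + cnj P * ?w)"
      using moebius_inverse_denom[OF d] .
    have "moebius P (?X t) = ?w" unfolding moebius_def[of P "?X t"] n1 n2 using divide_divide_cancel[OF d d2] .
    moreover have "?w \<in> closed_segment 0 ?q" using t by (auto simp: closed_segment_def)
    moreover have "?w \<noteq> 0" using t q0 by simp
    ultimately show ?thesis using Xh hsegment_moebius assms by (metis moebius_self)
  qed
  have "(?X \<longlongrightarrow> (0 *\<^sub>R ?q + P) / (1 + cnj P * (0 *\<^sub>R ?q))) (at_right 0)"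
    by (intro tendsto_intros) auto
  then have "filterlim ?X (at P within hsegment P Q) (at_right 0)"
    unfolding filterlim_at using Xt
    by (auto simp: eventually_at_right[of 0 1] intro!: exI[of _ 1])
  then have "at P within hsegment P Q \<noteq> bot"
    by (auto simp: filterlim_def filtermap_bot_iff dest!: bot.extremum_uniqueI)
  then show ?thesis using tendsto_Lim[OF _ L] by (simp add: hdir_def moebius_def)
qed

end

theory Submission
  imports Defs
begin

text \<open>
  All conditions are reduced to one equation. The isometry \<^term>\<open>moebius A\<close> moves \<open>A\<close> to the centre of the
  disc. Then \<open>B\<close> and \<open>C\<close> become complex numbers \<open>z\<close> and \<open>w\<close> of modulus \<open>tanh (c / 2)\<close> and
  \<open>tanh (b / 2)\<close>, and, for the positive orientation, \<open>u = cnj z * w\<close> equals \<open>k * cis \<alpha>\<close> with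
  \<open>k = tanh (b / 2) * tanh (c / 2) < 1\<close>. The equation is \<open>cos \<alpha> = k\<close>.

  Area. At each vertex, \<open>cis\<close> of the angle is the direction of an explicit
  polynomial in \<open>u\<close>, \<open>cnj u\<close> and the squared moduli. The product of the three is a negative
  multiple of \<open>(1 - u)\<^sup>2\<close>, and thus \<open>S / 2\<close> is the argument of
  \<open>1 - cnj u = 1 - k * cis (- \<alpha>)\<close> (lemmas \<open>harea_at_0\<close> and \<open>harea_polar\<close>). For fixed \<open>k\<close> this number
  moves on a half circle around \<open>1\<close> of radius \<open>k\<close>, so \<open>sin (S / 2) \<le> k\<close>, with equality at the
  point of tangency, where \<open>cos \<alpha> = k\<close> and \<open>S / 2 = pi / 2 - \<alpha>\<close> (lemma \<open>half_area_trig\<close>). The equality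
  case is condition (3). The relation \<open>S / 2 = pi / 2 - \<alpha>\<close> is \<open>\<alpha> = \<beta> + \<gamma>\<close>, because
  \<open>S\<close> is the defect, and then \<open>S > 0\<close> gives \<open>\<alpha> < pi / 2\<close>. As
  every angle between two given sides occurs (lemma \<open>htriangle_with_cos_exists\<close>), the bound is
  attained, so maximal area also means equality.

  Sides. The square of \<open>sinh\<close> of half a distance is a rational function of the coordinates
  (lemma \<open>sinh_half_hdist\<close>). With \<open>A\<close> at the centre, condition (5) becomes
  \<open>Re u = k\<^sup>2\<close>, that is \<open>cos \<alpha> = k\<close> (lemma \<open>sinh_sides_iff\<close>). With the midpoint of \<open>BC\<close> at the centre, it
  becomes the statement that \<open>A\<close> and \<open>B\<close> have equal modulus, that is condition (2)
  (lemma \<open>median_iff\<close>).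
\<close>

section \<open>Invariance of angles and area under isometries\<close>

lemma hdir_moebius:
  assumes "P \<in> hplane" "Q \<in> hplane" "P \<noteq> Q"
  shows "hdir P Q = sgn (moebius P Q)"
  using hdir_eq[OF assms] by (simp add: moebius_def)

lemma moebius_eq_0_iff:
  assumes "P \<in> hplane" "Q \<in> hplane"
  shows "moebius P Q = 0 \<longleftrightarrow> P = Q"
  using hdist_denom_nz[OF assms] by (auto simp: moebius_def)

lemma inner_sgn_complex: "sgn z \<bullet> sgn w = Re (sgn (cnj z * w))" for z w :: complex
  by (simp add: inner_complex_def sgn_eq norm_mult Re_divide_of_real Im_divide_of_real add_divide_distrib flip: of_real_mult)

text \<open>
  Turning a vector by \<open>\<phi>\<close> multiplies it by \<open>cis \<phi>\<close>, so with both sides of the angle transported to the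
  centre, the quotient of their directions, equivalently \<open>cnj z * w\<close> up to a positive factor, carries
  the angle.
\<close>
lemma hangle_moebius:
  assumes "P \<in> hplane" "Q \<in> hplane" "R \<in> hplane" "P \<noteq> Q" "P \<noteq> R"
  shows "hangle Q P R = arccos (Re (sgn (cnj (moebius P Q) * moebius P R)))"
  unfolding hangle_def hdir_moebius[OF assms(1,2,4)] hdir_moebius[OF assms(1,3,5)] inner_sgn_complex ..

lemma hangle_commute: "hangle Q P R = hangle R P Q"
  by (simp add: hangle_def inner_commute)

lemma harea_commute: "harea A B C = harea A C B"
  using hangle_commute[of B A C] by (simp add: harea_def)

text \<open>
  Moving \<open>P\<close> to the centre after a first isometry \<open>moebius A\<close> differs from moving it there directly
  by an isometry fixing the centre, that is by a rotation; the factor is a quotient of conjugates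
  that depends on \<open>P\<close> but not on \<open>Q\<close>.
\<close>
lemma moebius_moebius:
  assumes "A \<in> hplane" "P \<in> hplane" "Q \<in> hplane"
  shows "moebius (moebius A P) (moebius A Q) = (1 - A * cnj P) / (1 - cnj A * P) * moebius P Q"
proof -
  have nz: "1 - cnj A * P \<noteq> 0" "1 - cnj A * Q \<noteq> 0" "1 - A * cnj P \<noteq> 0" "1 - cnj A * A \<noteq> 0" "1 - cnj P * Q \<noteq> 0"
    using hdist_denom_nz[OF assms(1,2)] hdist_denom_nz[OF assms(1,3)] hdist_denom_nz[OF assms(2,1)]
      hdist_denom_nz[OF assms(1,1)] hdist_denom_nz[OF assms(2,3)] by (auto simp: mult.commute)
  have num: "moebius A Q - moebius A P = (Q - P) * (1 - cnj A * A) / ((1 - cnj A * Q) * (1 - cnj A * P))"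
    unfolding moebius_def diff_frac_eq[OF nz(2,1)]
    by (rule arg_cong[where f = "\<lambda>x. x / _"]) (simp add: algebra_simps)
  have "1 - cnj (moebius A P) * moebius A Q =
        ((1 - A * cnj P) * (1 - cnj A * Q) - (cnj P - cnj A) * (Q - A)) / ((1 - A * cnj P) * (1 - cnj A * Q))"
    using nz by (simp add: moebius_def diff_divide_distrib[of "(1 - A * cnj P) * (1 - cnj A * Q)"])
  also have "(1 - A * cnj P) * (1 - cnj A * Q) - (cnj P - cnj A) * (Q - A) = (1 - cnj P * Q) * (1 - cnj A * A)"
    by (simp add: algebra_simps)
  finally have den: "1 - cnj (moebius A P) * moebius A Q = (1 - cnj P * Q) * (1 - cnj A * A) / ((1 - A * cnj P) * (1 - cnj A * Q))" .
  show ?thesis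
    unfolding moebius_def[of "moebius A P"] num den moebius_def[of P] using nz by simp
qed

text \<open>
  Both sides of the angle are rotated by the same unit number \<open>e\<close>, which cancels in \<open>cnj z * w\<close>.
\<close>
lemma hangle_moebius_invariant:
  assumes "A \<in> hplane" "P \<in> hplane" "Q \<in> hplane" "R \<in> hplane" "P \<noteq> Q" "P \<noteq> R"
  shows "hangle (moebius A Q) (moebius A P) (moebius A R) = hangle Q P R"
proof -
  define e where "e = (1 - A * cnj P) / (1 - cnj A * P)"
  have nz: "1 - cnj A * P \<noteq> 0" "1 - A * cnj P \<noteq> 0"
    using hdist_denom_nz[OF assms(1,2)] hdist_denom_nz[OF assms(2,1)] by (auto simp: mult.commute)
  have e: "cnj e * e = 1" using nz by (simp add: e_def)
  then have e0: "e \<noteq> 0" by auto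
  have m: "moebius (moebius A P) (moebius A X) = e * moebius P X" if "X \<in> hplane" for X
    using moebius_moebius[OF assms(1,2) that] by (simp add: e_def)
  have in_hplane: "moebius A P \<in> hplane" "moebius A Q \<in> hplane" "moebius A R \<in> hplane"
    using assms moebius_in by blast+
  have "e * moebius P Q \<noteq> 0" "e * moebius P R \<noteq> 0"
    using e0 assms moebius_eq_0_iff by auto
  then have ne: "moebius A P \<noteq> moebius A Q" "moebius A P \<noteq> moebius A R"
    using m[OF assms(3)] m[OF assms(4)] by (metis moebius_self)+
  have "cnj (e * moebius P Q) * (e * moebius P R) = (cnj e * e) * (cnj (moebius P Q) * moebius P R)"
    by (simp add: ac_simps)
  then have "cnj (e * moebius P Q) * (e * moebius P R) = cnj (moebius P Q) * moebius P R"
    unfolding e by simp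
  then show ?thesis
    using assms(3-) unfolding hangle_moebius[OF in_hplane ne] hangle_moebius[OF assms(2-)]
    by (simp only: m)
qed

lemma harea_moebius_invariant:
  assumes "A \<in> hplane" "B \<in> hplane" "C \<in> hplane" "D \<in> hplane" "A \<noteq> B" "A \<noteq> C" "B \<noteq> C"
  shows "harea (moebius D A) (moebius D B) (moebius D C) = harea A B C"
  using assms by (simp add: harea_def hangle_moebius_invariant del: mem_ball)

text \<open>
  Taking \<open>sinh\<close> instead of \<open>tanh\<close> of half the distance makes the denominator split into one factor per
  point. Sums of such squares over sides with a common vertex are then compared by plain algebra.
\<close>
lemma sinh_half_hdist:
  assumes "z \<in> hplane" "w \<in> hplane"
  shows "(sinh (hdist z w / 2))\<^sup>2 = (norm (z - w))\<^sup>2 / ((1 - (norm z)\<^sup>2) * (1 - (norm w)\<^sup>2))"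
proof -
  let ?x = "hdist z w / 2"
  have n: "(norm (1 - cnj z * w))\<^sup>2 > 0" using hdist_denom_nz[OF assms] by simp
  have "(sinh ?x)\<^sup>2 = (cosh ?x)\<^sup>2 * (tanh ?x)\<^sup>2"
    by (simp add: tanh_def power_divide)
  then have "(sinh ?x)\<^sup>2 * (norm (1 - cnj z * w))\<^sup>2 = (1 + (sinh ?x)\<^sup>2) * (norm (z - w))\<^sup>2"
    using n by (simp add: tanh_hdist[OF assms] power_divide cosh_square_eq add.commute eq_divide_eq)
  then have e: "(sinh ?x)\<^sup>2 * ((1 - (norm z)\<^sup>2) * (1 - (norm w)\<^sup>2)) = (norm (z - w))\<^sup>2"
    unfolding hdist_norm_identity[of z w, symmetric] by (simp add: algebra_simps)
  have "1 - (norm z)\<^sup>2 > 0" "1 - (norm w)\<^sup>2 > 0" using assms by (simp_all add: abs_square_less_1)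
  then show ?thesis unfolding e[symmetric] by simp
qed

lemma hdist_commute: "hdist z w = hdist w z"
proof -
  have "norm (1 - cnj z * w) = norm (1 - cnj w * z)"
    using complex_mod_cnj[of "1 - cnj w * z"] by (simp add: mult.commute)
  then show ?thesis by (simp add: hdist_def norm_minus_commute)
qed

lemma hdist_pos: "z \<in> hplane \<Longrightarrow> w \<in> hplane \<Longrightarrow> z \<noteq> w \<Longrightarrow> hdist z w > 0"
  using tanh_hdist[of z w] hdist_denom_nz[of z w] tanh_real_pos_iff[of "hdist z w / 2"] by simp

lemma hdist_nonneg: "z \<in> hplane \<Longrightarrow> w \<in> hplane \<Longrightarrow> hdist z w \<ge> 0"
  using hdist_pos[of z w] by (cases "z = w") (auto simp: hdist_def)

lemma hdist_0_eqI:
  assumes "z \<in> hplane" "norm z = tanh (d / 2)"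
  shows "hdist 0 z = d"
  using strict_mono_eq[OF tanh_real_strict_mono, of "hdist 0 z / 2" "d / 2"] tanh_hdist_0[OF assms(1)] assms(2)
  by simp

lemma sides_from_moebius:
  assumes "A \<in> hplane" "B \<in> hplane" "C \<in> hplane"
  shows "hdist A B = hdist 0 (moebius A B)" "hdist A C = hdist 0 (moebius A C)"
    "hdist B C = hdist (moebius A B) (moebius A C)"
  using moebius_hdist[of A A B] moebius_hdist[of A A C] moebius_hdist[of A B C] assms by auto

section \<open>Lines and the orientation of a triangle\<close>

text \<open>
  The equation of a line through \<open>A\<close>, cleared of denominators: quadratic part \<open>(norm X)\<^sup>2\<close>, so a circle,
  unless \<open>Im (cnj v * A)\<close> vanishes.
\<close>
lemma Im_moebius_numerator:
  fixes v A X :: complex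
  shows "Im (cnj v * ((X - A) * cnj (1 - cnj A * X)))
       = Re (cnj X * (\<i> * (v - cnj v * A\<^sup>2))) - (1 + (norm X)\<^sup>2) * Im (cnj v * A)"
  by (simp add: cmod_power2) (simp add: power2_eq_square algebra_simps)

text \<open>
  Isometries carry diameters to lines. This connects the definition of a triangle by lines with
  the orientation number \<open>Im (cnj z * w)\<close>.
\<close>
lemma hline_moebius_diameter:
  assumes A: "A \<in> hplane" and v: "v \<noteq> 0"
  shows "hline {X \<in> hplane. Im (cnj v * moebius A X) = 0}"
proof -
  let ?h = "Im (cnj v * A)"
  have A1: "1 - (norm A)\<^sup>2 > 0" using A by (simp add: abs_square_less_1)
  have iff: "Im (cnj v * moebius A X) = 0 \<longleftrightarrow>
      Re (cnj X * (\<i> * (v - cnj v * A\<^sup>2))) = (1 + (norm X)\<^sup>2) * ?h" if "X \<in> hplane" for X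
  proof -
    let ?d = "1 - cnj A * X"
    have d: "?d \<noteq> 0" using hdist_denom_nz A that by blast
    then have "cnj ?d \<noteq> 0" by (metis complex_cnj_zero_iff)
    then have "cnj v * moebius A X = cnj v * ((X - A) * cnj ?d) / of_real ((norm ?d)\<^sup>2)"
      unfolding complex_norm_square using d by (simp add: moebius_def)
    then have "Im (cnj v * moebius A X) = Im (cnj v * ((X - A) * cnj ?d)) / (norm ?d)\<^sup>2"
      by (simp only: Im_divide_of_real)
    then show ?thesis using d Im_moebius_numerator[of v X A] by simp
  qed
  show ?thesis
  proof (cases "?h = 0")
    case True
    \<comment> \<open>Here \<open>A\<close> is a real multiple of \<open>v\<close>, so the diameter in direction \<open>v\<close> passes through \<open>A\<close>.\<close>
    have "Re (cnj X * (\<i> * (v - cnj v * A\<^sup>2))) = Im (cnj v * X) * (1 - (norm A)\<^sup>2)" for X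
    proof -
      have "cnj v * A = v * cnj A"
        using True by (simp add: complex_eq_iff algebra_simps)
      then have "cnj v * A\<^sup>2 = v * of_real ((norm A)\<^sup>2)"
        unfolding complex_norm_square by (simp add: power2_eq_square algebra_simps)
      then have "v - cnj v * A\<^sup>2 = (1 - (norm A)\<^sup>2) *\<^sub>R v"
        by (simp add: scaleR_conv_of_real algebra_simps)
      then have "Re (cnj X * (\<i> * (v - cnj v * A\<^sup>2))) = Re (cnj X * (\<i> * ((1 - (norm A)\<^sup>2) *\<^sub>R v)))"
        by (simp only:)
      also have "\<dots> = Im (cnj v * X) * (1 - (norm A)\<^sup>2)" by (simp add: algebra_simps)
      finally show ?thesis .
    qed
    then have "{X \<in> hplane. Im (cnj v * moebius A X) = 0} = {X \<in> hplane. Im (cnj v * X) = 0}"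
      using iff True A1 by auto
    also have "\<dots> = hplane \<inter> range (\<lambda>t::real. t *\<^sub>R v)"
    proof -
      have "(Im (cnj v * X) = 0) = (X \<in> range (\<lambda>t::real. t *\<^sub>R v))" for X
      proof
        assume "Im (cnj v * X) = 0"
        then have "cnj v * X = of_real (Re (cnj v * X))" by (simp add: complex_eq_iff)
        then have "v * cnj v * X = v * of_real (Re (cnj v * X))" by (simp add: mult.assoc)
        then have "X = (Re (cnj v * X) / (norm v)\<^sup>2) *\<^sub>R v"
          using v unfolding complex_norm_square[symmetric] by (simp add: scaleR_conv_of_real field_simps)
        then show "X \<in> range (\<lambda>t::real. t *\<^sub>R v)" by blast
      qed (auto simp: algebra_simps)
      then show ?thesis by auto
    qed
    finally show ?thesis unfolding hline_def using v by blast
  next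
    case False
    \<comment> \<open>Dividing the equation by \<open>?h\<close> turns it into \<open>(norm X)\<^sup>2 - 2 * Re (cnj X * p) + 1 = 0\<close>, the
      circle with centre \<open>p\<close> and squared radius \<open>(norm p)\<^sup>2 - 1\<close>.\<close>
    define p where "p = \<i> * (v - cnj v * A\<^sup>2) / of_real (2 * ?h)"
    have "complex_of_real (2 * ?h) \<noteq> 0" using False by (simp only: of_real_eq_0_iff)
    then have p: "\<i> * (v - cnj v * A\<^sup>2) = of_real (2 * ?h) * p"
      by (simp only: p_def times_divide_eq_right nonzero_mult_div_cancel_left not_False_eq_True)
    \<comment> \<open>This identity gives \<open>norm p > 1\<close>, so that the circle is real.\<close>
    have "(norm (v - cnj v * A\<^sup>2))\<^sup>2 - (2 * ?h)\<^sup>2 = (norm v)\<^sup>2 * (1 - (norm A)\<^sup>2)\<^sup>2"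
      by (simp add: cmod_power2) (simp add: power2_eq_square algebra_simps)
    then have "(norm (v - cnj v * A\<^sup>2))\<^sup>2 > (2 * ?h)\<^sup>2"
      using v A1 by (smt (verit) zero_less_mult_iff zero_less_norm_iff zero_less_power)
    moreover have "(norm (v - cnj v * A\<^sup>2))\<^sup>2 = (2 * ?h)\<^sup>2 * (norm p)\<^sup>2"
      using arg_cong[OF p, of "\<lambda>x. (norm x)\<^sup>2"] by (simp only: norm_mult norm_ii norm_of_real power_mult_distrib power2_abs) simp
    ultimately have "(norm p)\<^sup>2 > 1" using False by simp
    define r where "r = sqrt ((norm p)\<^sup>2 - 1)"
    have r: "r > 0" "(norm p)\<^sup>2 = 1 + r\<^sup>2" using \<open>(norm p)\<^sup>2 > 1\<close> by (auto simp: r_def)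
    have cancel: "2 * h * q = n * h \<longleftrightarrow> 2 * q = n" if "h \<noteq> 0" for h q n :: real
      using that by (auto simp: mult.commute[of _ h])
    have "Im (cnj v * moebius A X) = 0 \<longleftrightarrow> X \<in> sphere p r" if "X \<in> hplane" for X
    proof -
      have "Re (cnj X * (of_real (2 * ?h) * p)) = 2 * ?h * Re (cnj X * p)"
        by (simp add: algebra_simps)
      then have "Im (cnj v * moebius A X) = 0 \<longleftrightarrow> 2 * Re (cnj X * p) = 1 + (norm X)\<^sup>2"
        unfolding iff[OF that] p using cancel[OF False] by (simp only:)
      also have "\<dots> \<longleftrightarrow> (norm (p - X))\<^sup>2 = r\<^sup>2"
      proof -
        have "(norm (p - X))\<^sup>2 = (norm p)\<^sup>2 + (norm X)\<^sup>2 - 2 * Re (cnj X * p)"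
          by (simp add: cmod_power2) (simp add: power2_eq_square algebra_simps)
        then show ?thesis using r(2) by auto
      qed
      also have "\<dots> \<longleftrightarrow> X \<in> sphere p r" using r(1) by (simp add: dist_norm)
      finally show ?thesis .
    qed
    then have "{X \<in> hplane. Im (cnj v * moebius A X) = 0} = hplane \<inter> sphere p r" by auto
    then show ?thesis unfolding hline_def using r by blast
  qed
qed

text \<open>
  If the number were real, the line through \<open>A\<close> and \<open>B\<close> given by the previous lemma would contain \<open>C\<close>.
\<close>
lemma htriangle_moebius_Im:
  assumes "htriangle A B C" "A \<noteq> B"
  shows "Im (cnj (moebius A B) * moebius A C) \<noteq> 0"
proof
  assume "Im (cnj (moebius A B) * moebius A C) = 0"
  moreover have h: "A \<in> hplane" "B \<in> hplane" "C \<in> hplane" using assms by (auto simp: htriangle_def)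
  moreover have "moebius A B \<noteq> 0" using moebius_eq_0_iff h assms by blast
  ultimately have "hline {X \<in> hplane. Im (cnj (moebius A B) * moebius A X) = 0}"
    "A \<in> {X \<in> hplane. Im (cnj (moebius A B) * moebius A X) = 0}"
    "B \<in> {X \<in> hplane. Im (cnj (moebius A B) * moebius A X) = 0}"
    "C \<in> {X \<in> hplane. Im (cnj (moebius A B) * moebius A X) = 0}"
    using hline_moebius_diameter by auto
  then show False using assms(1) unfolding htriangle_def by blast
qed

text \<open>
  A circle orthogonal to the unit circle avoids the centre, so lines through \<open>0\<close> are diameters.
\<close>
lemma htriangle_at_0:
  assumes "z \<in> hplane" "w \<in> hplane" "Im (cnj z * w) \<noteq> 0"
  shows "htriangle 0 z w"
proof -
  have False if L: "hline L" "0 \<in> L" "z \<in> L" "w \<in> L" for L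
    using L(1) unfolding hline_def
  proof (elim disjE exE conjE)
    fix u assume "L = hplane \<inter> range (\<lambda>t::real. t *\<^sub>R u)"
    then obtain s t :: real where "z = s *\<^sub>R u" "w = t *\<^sub>R u" using L by blast
    then show False using assms(3) by simp
  next
    fix p r assume "(norm p)\<^sup>2 = 1 + r\<^sup>2" "L = hplane \<inter> sphere p r"
    then show False using L(2) by simp
  qed
  then show ?thesis using assms unfolding htriangle_def by auto
qed

section \<open>The area as the argument of a complex number\<close>

text \<open>
  Dividing by \<open>cnj d\<close> and multiplying by \<open>d\<close> give the same direction; this keeps the products of
  directions polynomial.
\<close>
lemma divide_cnj: "x / cnj d = (1 / (norm d)\<^sup>2) *\<^sub>R (x * d)" for x d :: complex
  by (cases "d = 0") (simp_all add: scaleR_conv_of_real complex_norm_square field_simps del: of_real_power)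

lemma sgn_divide_cnj: "d \<noteq> 0 \<Longrightarrow> sgn (x / cnj d) = sgn (x * d)" for x d :: complex
  unfolding divide_cnj sgn_scaleR by simp

lemma Im_divide_cnj_pos: "Im (x * d) > 0 \<Longrightarrow> Im (x / cnj d) > 0" for x d :: complex
  unfolding divide_cnj scaleR_complex.simps by (intro mult_pos_pos) (auto simp: zero_less_divide_iff)

text \<open>
  An angle defined by \<open>arccos\<close> forgets the sense of rotation. In the upper half plane it is nevertheless
  the argument, so that angles can be added by multiplying complex numbers.
\<close>
lemma cis_arccos_Re_sgn:
  assumes "Im u > 0"
  shows "cis (arccos (Re (sgn u))) = sgn u" "0 < arccos (Re (sgn u))" "arccos (Re (sgn u)) < pi"
proof -
  let ?s = "sgn u"
  have "u \<noteq> 0" using assms by auto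
  then have "norm ?s = 1" by (simp add: norm_sgn)
  then have e: "(Re ?s)\<^sup>2 + (Im ?s)\<^sup>2 = 1" using cmod_power2[of ?s] by simp
  have i: "Im ?s > 0" using assms \<open>u \<noteq> 0\<close> by (simp add: sgn_eq Im_divide_of_real)
  then have "(Re ?s)\<^sup>2 < 1" using e by (smt (verit) zero_less_power)
  then have "\<bar>Re ?s\<bar> < 1" by (simp only: abs_square_less_1)
  then have r: "-1 < Re ?s" "Re ?s < 1" by linarith+
  have "sqrt (1 - (Re ?s)\<^sup>2) = Im ?s" using e i by (intro real_sqrt_unique) auto
  then show "cis (arccos (Re ?s)) = ?s" using r by (simp add: complex_eq_iff sin_arccos_abs cos_arccos sin_arccos)
  show "0 < arccos (Re ?s)" "arccos (Re ?s) < pi" using arccos_lt_bounded[of "Re ?s"] r by auto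
qed

lemma cis_hangle:
  assumes "P \<in> hplane" "Q \<in> hplane" "R \<in> hplane" "Im (cnj (moebius P Q) * moebius P R) > 0"
  shows "cis (hangle Q P R) = sgn (cnj (moebius P Q) * moebius P R)"
    and "0 < hangle Q P R" and "hangle Q P R < pi"
proof -
  have "P \<noteq> Q" "P \<noteq> R" using assms(4) by auto
  then show "cis (hangle Q P R) = sgn (cnj (moebius P Q) * moebius P R)"
    "0 < hangle Q P R" "hangle Q P R < pi"
    using cis_arccos_Re_sgn[OF assms(4)] assms by (simp_all only: hangle_moebius not_False_eq_True)
qed

text \<open>
  In a positively oriented triangle \<open>0, z, w\<close> all three angles are turned in the same sense, so that the
  unit numbers of the angles, and not only their real parts, are known. With \<open>u = cnj z * w\<close>
  all of them are expressed by \<open>u\<close> and the moduli of \<open>z\<close> and \<open>w\<close>.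
\<close>
lemma angles_at_0:
  fixes z w :: complex
  defines "u \<equiv> cnj z * w"
  assumes zw: "z \<in> hplane" "w \<in> hplane" and u: "Im u > 0"
  shows "cis (hangle z 0 w) = sgn u" "0 < hangle z 0 w" "hangle z 0 w < pi"
    and "cis (hangle 0 z w) = sgn ((of_real ((norm z)\<^sup>2) - cnj u) * (1 - u))" "0 < hangle 0 z w" "hangle 0 z w < pi"
    and "cis (hangle 0 w z) = sgn ((of_real ((norm w)\<^sup>2) - cnj u) * (1 - u))" "0 < hangle 0 w z" "hangle 0 w z < pi"
proof -
  have d: "1 - u \<noteq> 0" using hdist_denom_nz[OF zw] by (simp add: u_def)
  have n: "(norm z)\<^sup>2 < 1" "(norm w)\<^sup>2 < 1" using zw by (auto simp: abs_square_less_1)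
  show "cis (hangle z 0 w) = sgn u" "0 < hangle z 0 w" "hangle z 0 w < pi"
    using cis_hangle[of 0 z w] zw u by (auto simp: moebius_def u_def)
  have Im: "Im ((of_real s - cnj u) * (1 - u)) > 0" if "s < 1" for s
  proof -
    have "Im ((of_real s - cnj u) * (1 - u)) = Im u * (1 - s)" by (simp add: algebra_simps)
    then show ?thesis using u that by simp
  qed
  have z: "cnj (moebius z w) * moebius z 0 = (of_real ((norm z)\<^sup>2) - cnj u) / cnj (1 - u)"
    unfolding complex_norm_square by (simp add: moebius_def u_def algebra_simps diff_divide_distrib)
  have w: "cnj (moebius w 0) * moebius w z = (of_real ((norm w)\<^sup>2) - cnj u) / cnj (1 - u)"
    unfolding complex_norm_square by (simp add: moebius_def u_def algebra_simps diff_divide_distrib)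
  show "cis (hangle 0 z w) = sgn ((of_real ((norm z)\<^sup>2) - cnj u) * (1 - u))" "0 < hangle 0 z w" "hangle 0 z w < pi"
    using cis_hangle[of z w 0] zw Im_divide_cnj_pos[OF Im[OF n(1)]]
    unfolding z hangle_commute[of w z 0] sgn_divide_cnj[OF d] by auto
  show "cis (hangle 0 w z) = sgn ((of_real ((norm w)\<^sup>2) - cnj u) * (1 - u))" "0 < hangle 0 w z" "hangle 0 w z < pi"
    using cis_hangle[of w 0 z] zw Im_divide_cnj_pos[OF Im[OF n(2)]]
    unfolding w sgn_divide_cnj[OF d] by auto
qed

text \<open>
  Multiplying the three unit numbers of the angles gives \<open>cis\<close> of the angle sum. The product is
  \<open>- (norm u)\<^sup>2 * (norm (z - w))\<^sup>2 * (1 - u)\<^sup>2\<close>, because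
  \<open>(norm z)\<^sup>2 * (norm w)\<^sup>2 = u * cnj u\<close> and \<open>u + cnj u - (norm z)\<^sup>2 - (norm w)\<^sup>2 = - (norm (z - w))\<^sup>2\<close>.
  Hence half the defect is the argument of \<open>1 - cnj u\<close>, a number with positive real part.
\<close>
lemma harea_at_0:
  fixes z w :: complex
  defines "u \<equiv> cnj z * w"
  assumes zw: "z \<in> hplane" "w \<in> hplane" and u: "Im u > 0"
  shows "cis (harea 0 z w / 2) = sgn (1 - cnj u)" "0 < harea 0 z w" "harea 0 z w < pi"
proof -
  let ?a = "hangle z 0 w" and ?b = "hangle 0 z w" and ?c = "hangle 0 w z" and ?S = "harea 0 z w"
  let ?fz = "of_real ((norm z)\<^sup>2) - cnj u" and ?fw = "of_real ((norm w)\<^sup>2) - cnj u"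
  note ang = angles_at_0[OF zw u[unfolded u_def], folded u_def]
  have d: "1 - u \<noteq> 0" using hdist_denom_nz[OF zw] by (simp add: u_def)
  have n: "(norm z)\<^sup>2 < 1" "(norm w)\<^sup>2 < 1" using zw by (auto simp: abs_square_less_1)
  have zw0: "z \<noteq> 0" "w \<noteq> 0" "z \<noteq> w" using u by (auto simp: u_def)
  have u0: "u \<noteq> 0" using u by auto
  have uu: "of_real ((norm z)\<^sup>2) * of_real ((norm w)\<^sup>2) = u * cnj u"
    unfolding complex_norm_square by (simp add: u_def)
  have nu: "(norm u)\<^sup>2 = (norm z)\<^sup>2 * (norm w)\<^sup>2" by (simp add: u_def norm_mult power_mult_distrib)
  show Slt: "?S < pi" using ang by (simp add: harea_def)
  \<comment> \<open>The product formula below fixes the area only modulo \<open>2 * pi\<close>; two angles summing to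
    less than \<open>pi\<close> keep half the area in the interval from \<open>- pi / 2\<close> to \<open>pi / 2\<close>.\<close>
  have ab: "?a + ?b < pi"
  proof (rule ccontr)
    assume "\<not> ?a + ?b < pi"
    then have "sin (?a + ?b) \<le> 0" using ang by (intro sin_le_zero) auto
    moreover have "cis (?a + ?b) = sgn (u * (?fz * (1 - u)))"
      using ang by (simp add: cis_mult[symmetric] sgn_mult)
    ultimately have "Im (u * (?fz * (1 - u))) \<le> 0"
      by (smt (verit) cis.sel(2) sgn_eq Im_divide_of_real divide_le_0_iff norm_ge_zero norm_eq_zero zero_complex.sel(2))
    moreover have "Im (u * (?fz * (1 - u))) = Im u * (norm z)\<^sup>2 * ((norm (z - w))\<^sup>2 + (1 - (norm z)\<^sup>2))"
    proof -
      have "Im (u * (?fz * (1 - u))) = Im u * ((norm z)\<^sup>2 - 2 * (norm z)\<^sup>2 * Re u + (norm u)\<^sup>2)"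
        by (simp add: cmod_power2[of u]) (simp add: algebra_simps power2_eq_square)
      also have "\<dots> = Im u * (norm z)\<^sup>2 * (1 - 2 * Re u + (norm w)\<^sup>2)"
        unfolding nu by (simp add: algebra_simps)
      also have "1 - 2 * Re u + (norm w)\<^sup>2 = (norm (z - w))\<^sup>2 + (1 - (norm z)\<^sup>2)"
        by (simp add: cmod_power2 u_def) (simp add: algebra_simps power2_eq_square)
      finally show ?thesis .
    qed
    ultimately show False using u n zw0
      by (smt (verit) mult_pos_pos zero_less_norm_iff zero_less_power zero_le_power2)
  qed
  have "cis (?a + ?b + ?c) = sgn (u * (?fz * (1 - u)) * (?fw * (1 - u)))"
    using ang by (simp add: cis_mult[symmetric] sgn_mult)
  also have "u * (?fz * (1 - u)) * (?fw * (1 - u)) = - ((norm u)\<^sup>2 * (norm (z - w))\<^sup>2) *\<^sub>R (1 - u)\<^sup>2"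
  proof -
    have "?fz * ?fw = u * cnj u - cnj u * (of_real ((norm z)\<^sup>2) + of_real ((norm w)\<^sup>2)) + (cnj u)\<^sup>2"
      unfolding uu[symmetric] by (simp add: algebra_simps power2_eq_square)
    also have "\<dots> = - cnj u * of_real ((norm (z - w))\<^sup>2)"
      unfolding complex_norm_square by (simp add: u_def algebra_simps power2_eq_square)
    finally have "u * (?fz * ?fw) * (1 - u)\<^sup>2 = - (u * cnj u) * of_real ((norm (z - w))\<^sup>2) * (1 - u)\<^sup>2"
      by simp
    then show ?thesis unfolding complex_norm_square[symmetric]
      by (simp add: scaleR_conv_of_real power2_eq_square[of "1 - u"] ac_simps)
  qed
  also have "sgn \<dots> = - ((sgn (1 - u))\<^sup>2)"
    using u0 zw0 by (simp add: sgn_scaleR sgn_mult power2_eq_square sgn_minus)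
  finally have sum: "cis (?a + ?b + ?c) = - ((sgn (1 - u))\<^sup>2)" .
  have "cis ?S = - cnj (cis (?a + ?b + ?c))"
    by (simp add: harea_def complex_eq_iff cos_diff sin_diff sin_add cos_add algebra_simps)
  then have "(cis (?S / 2))\<^sup>2 = (sgn (1 - cnj u))\<^sup>2"
    unfolding sum by (simp add: power2_eq_square cis_mult sgn_eq flip: complex_mod_cnj[of "1 - u"])
  then have "cis (?S / 2) = sgn (1 - cnj u) \<or> cis (?S / 2) = - sgn (1 - cnj u)"
    by (simp add: power2_eq_iff)
  moreover have "Re (cis (?S / 2)) > 0"
    using Slt ab ang by (simp add: harea_def cos_gt_zero_pi)
  moreover have "Re (sgn (1 - cnj u)) \<ge> 0"
  proof -
    have "norm u \<le> 1" using nu n by (smt (verit) mult_left_le power_le_one_iff norm_ge_zero zero_le_power2 power2_le_imp_le one_power2)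
    then have "Re u \<le> 1" using complex_Re_le_cmod order_trans by blast
    then show ?thesis by (simp add: sgn_eq Re_divide_of_real)
  qed
  ultimately show half: "cis (?S / 2) = sgn (1 - cnj u)" by (metis add.inverse_inverse leD neg_0_less_iff_less uminus_complex.sel(1))
  have "1 - cnj u \<noteq> 0" using d by (metis complex_cnj_diff complex_cnj_one complex_cnj_zero_iff)
  then have "Im (sgn (1 - cnj u)) > 0" using u by (simp add: sgn_eq Im_divide_of_real)
  then have "sin (?S / 2) > 0" unfolding half[symmetric] by simp
  then show "?S > 0" using sin_le_zero[of "?S / 2 + 2 * pi"] Slt ab ang
    by (smt (verit) harea_def sin_ge_zero sin_minus field_sum_of_halves)
qed

lemma norm_moebius_tanh:
  assumes "A \<in> hplane" "B \<in> hplane"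
  shows "norm (moebius A B) = tanh (hdist A B / 2)"
  using assms by (simp add: norm_moebius tanh_hdist)

text \<open>
  The area in terms of two sides and the enclosed angle: \<open>R\<close> and half the area are the polar
  coordinates of \<open>1 - k * cis (- \<alpha>)\<close>. The last equation links \<open>\<alpha>\<close> to the coordinates used for the sides.
\<close>
lemma harea_polar:
  assumes "htriangle A B C" "A \<noteq> B" "A \<noteq> C"
  defines "k \<equiv> tanh (hdist A C / 2) * tanh (hdist A B / 2)"
  obtains R where "R > 0" "R * cos (harea A B C / 2) = 1 - k * cos (hangle B A C)"
    "R * sin (harea A B C / 2) = k * sin (hangle B A C)"
    "0 < harea A B C" "harea A B C < pi" "0 < hangle B A C" "hangle B A C < pi"
    "k * cos (hangle B A C) = Re (cnj (moebius A B) * moebius A C)"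
proof -
  \<comment> \<open>The claim is symmetric in \<open>B\<close> and \<open>C\<close>; naming it as a predicate lets the negatively oriented
    case follow by exchanging them.\<close>
  define thesis' where "thesis' \<equiv> \<lambda>B C. \<exists>R. R > 0 \<and> R * cos (harea A B C / 2) = 1 - k * cos (hangle B A C) \<and>
    R * sin (harea A B C / 2) = k * sin (hangle B A C) \<and>
    0 < harea A B C \<and> harea A B C < pi \<and> 0 < hangle B A C \<and> hangle B A C < pi \<and>
    k * cos (hangle B A C) = Re (cnj (moebius A B) * moebius A C)"
  have h: "A \<in> hplane" "B \<in> hplane" "C \<in> hplane" using assms(1) by (auto simp: htriangle_def)
  have pos: "thesis' B C"
    if h: "B \<in> hplane" "C \<in> hplane" and ne: "A \<noteq> B" "A \<noteq> C" and k: "k = norm (moebius A B) * norm (moebius A C)"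
      and Im: "Im (cnj (moebius A B) * moebius A C) > 0" for B C
  proof -
    let ?z = "moebius A B" and ?w = "moebius A C"
    define u where "u = cnj ?z * ?w"
    have u: "Im u > 0" using Im by (simp add: u_def)
    have ku: "k = norm u" by (simp add: k u_def norm_mult)
    have zw: "?z \<in> hplane" "?w \<in> hplane" using h \<open>A \<in> hplane\<close> moebius_in by blast+
    have "B \<noteq> C" using Im by auto
    then have S: "harea 0 ?z ?w = harea A B C" and \<alpha>: "hangle ?z 0 ?w = hangle B A C"
      using harea_moebius_invariant[of A B C A] hangle_moebius_invariant[of A A B C] h ne \<open>A \<in> hplane\<close>
      by (simp_all del: mem_ball)
    note ang = angles_at_0(1-3)[OF zw Im, folded u_def, unfolded \<alpha>]
    note area = harea_at_0[OF zw Im, folded u_def, unfolded S]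
    have u0: "u \<noteq> 0" "1 - cnj u \<noteq> 0" using u by auto
    have R: "norm (1 - cnj u) > 0" using u0 by simp
    have "Re (cis (harea A B C / 2)) = (1 - Re u) / norm (1 - cnj u)"
      "Im (cis (harea A B C / 2)) = Im u / norm (1 - cnj u)"
      unfolding area(1) sgn_eq by (simp_all add: Re_divide_of_real Im_divide_of_real)
    then have "norm (1 - cnj u) * cos (harea A B C / 2) = 1 - Re u"
      "norm (1 - cnj u) * sin (harea A B C / 2) = Im u" using u0 by simp_all
    moreover have "Re (cis (hangle B A C)) = Re u / k" "Im (cis (hangle B A C)) = Im u / k"
      unfolding ang(1) sgn_eq ku by (simp_all add: Re_divide_of_real Im_divide_of_real)
    then have "k * cos (hangle B A C) = Re u" "k * sin (hangle B A C) = Im u" using u0 ku by simp_all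
    ultimately have
      "norm (1 - cnj u) * cos (harea A B C / 2) = 1 - k * cos (hangle B A C)"
      "norm (1 - cnj u) * sin (harea A B C / 2) = k * sin (hangle B A C)"
      "k * cos (hangle B A C) = Re (cnj ?z * ?w)" by (simp_all only: u_def)
    then show ?thesis unfolding thesis'_def using ang area R by blast
  qed
  have k: "k = norm (moebius A B) * norm (moebius A C)"
    using h by (simp add: k_def norm_moebius_tanh del: mem_ball)
  have "thesis' B C"
  proof (cases "Im (cnj (moebius A B) * moebius A C) > 0")
    case True
    then show ?thesis using pos h assms k by blast
  next
    case False
    then have "Im (cnj (moebius A C) * moebius A B) > 0"
      using htriangle_moebius_Im[OF assms(1,2)] by (simp add: algebra_simps)
    then have "thesis' C B" using pos[of C B] h assms k by (simp add: mult.commute del: mem_ball)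
    moreover have "Re (cnj (moebius A C) * moebius A B) = Re (cnj (moebius A B) * moebius A C)"
      by (simp add: algebra_simps)
    ultimately show ?thesis
      unfolding thesis'_def by (simp only: harea_commute[of A C B] hangle_commute[of C A B])
  qed
  then show ?thesis using that unfolding thesis'_def by blast
qed

section \<open>Maximality of the area as tangency to a circle\<close>

text \<open>
  As \<open>\<alpha>\<close> varies, \<open>1 - k * cis (- \<alpha>)\<close> runs over a half circle around \<open>1\<close> with radius \<open>k\<close>. For \<open>k < 1\<close> its argument \<open>s\<close>
  is largest where the ray from \<open>0\<close> is tangent to the circle; there \<open>sin s = k\<close> and
  the right triangle with vertices \<open>0\<close>, \<open>1\<close> and the point of tangency gives
  \<open>cos \<alpha> = k\<close> and \<open>s + \<alpha> = pi / 2\<close>. The algebraic form of tangency is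
  \<open>R\<^sup>2 = (sin \<alpha>)\<^sup>2 + (cos \<alpha> - k)\<^sup>2\<close>.
\<close>
lemma half_area_trig:
  fixes R s k \<alpha> :: real
  assumes R: "R > 0" and c: "R * cos s = 1 - k * cos \<alpha>" and s: "R * sin s = k * sin \<alpha>"
    and \<alpha>: "0 < \<alpha>" "\<alpha> < pi" and s_bounds: "0 < s" "s < pi / 2" and k: "k > 0"
  shows "sin s \<le> k" "sin s = k \<longleftrightarrow> cos \<alpha> = k" "s = pi / 2 - \<alpha> \<longleftrightarrow> cos \<alpha> = k"
proof -
  have sin\<alpha>: "sin \<alpha> > 0" using \<alpha> by (simp add: sin_gt_zero)
  have "R\<^sup>2 = (R * cos s)\<^sup>2 + (R * sin s)\<^sup>2"
    by (simp add: power_mult_distrib distrib_left[symmetric])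
  also have "\<dots> = 1 - 2 * k * cos \<alpha> + k\<^sup>2 * ((sin \<alpha>)\<^sup>2 + (cos \<alpha>)\<^sup>2)"
    unfolding c s
    by (simp add: power2_eq_square algebra_simps
        del: sin_cos_squared_add sin_cos_squared_add2 sin_cos_squared_add3)
  also have "\<dots> = (sin \<alpha>)\<^sup>2 + (cos \<alpha> - k)\<^sup>2"
    using sin_cos_squared_add[of \<alpha>] by (simp add: power2_diff)
  finally have R2: "R\<^sup>2 = (sin \<alpha>)\<^sup>2 + (cos \<alpha> - k)\<^sup>2" .
  then have "(sin \<alpha>)\<^sup>2 \<le> R\<^sup>2" by simp
  then have "sin \<alpha> \<le> R" by (rule power2_le_imp_le) (use R in simp)
  then have "k * sin \<alpha> \<le> k * R" using k by simp
  then have "R * sin s \<le> R * k" by (simp only: s mult.commute)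
  then show "sin s \<le> k" using R by simp
  have "sin s = k \<longleftrightarrow> R * sin s = R * k" using R by simp
  also have "\<dots> \<longleftrightarrow> sin \<alpha> = R" using k unfolding s by auto
  also have "\<dots> \<longleftrightarrow> (sin \<alpha>)\<^sup>2 = R\<^sup>2" using R sin\<alpha> by simp
  also have "\<dots> \<longleftrightarrow> cos \<alpha> = k" unfolding R2 by simp
  finally show eq: "sin s = k \<longleftrightarrow> cos \<alpha> = k" .
  show "s = pi / 2 - \<alpha> \<longleftrightarrow> cos \<alpha> = k"
  proof
    assume "s = pi / 2 - \<alpha>"
    then have "sin s = cos \<alpha>" "cos s = sin \<alpha>" using cos_sin_eq[of \<alpha>] sin_cos_eq[of \<alpha>] by simp_all
    then have "R * sin \<alpha> = 1 - k * cos \<alpha>" "R * cos \<alpha> = k * sin \<alpha>" using c s by simp_all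
    then have "(1 - k * cos \<alpha>) * cos \<alpha> = k * sin \<alpha> * sin \<alpha>" by (metis mult.commute mult.left_commute)
    then have "cos \<alpha> = k * ((sin \<alpha>)\<^sup>2 + (cos \<alpha>)\<^sup>2)"
      by (simp add: power2_eq_square algebra_simps
          del: sin_cos_squared_add sin_cos_squared_add2 sin_cos_squared_add3)
    then show "cos \<alpha> = k" by simp
  next
    assume a: "cos \<alpha> = k"
    then have "\<alpha> < pi / 2" using k \<alpha> by (smt (verit) cos_monotone_0_pi_le cos_pi_half pi_half_ge_zero)
    moreover have "sin s = sin (pi / 2 - \<alpha>)" using eq a cos_sin_eq[of \<alpha>] by simp
    ultimately show "s = pi / 2 - \<alpha>" using \<alpha> s_bounds sin_inj_pi[of s "pi / 2 - \<alpha>"] by auto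
  qed
qed

text \<open>
  With \<open>t = tanh (b / 2) * tanh (c / 2)\<close> this supplies the triangle of maximal area. The vertices are \<open>0\<close>,
  a point on the real axis, and a point in the direction \<open>cis (arccos t)\<close>.
\<close>
lemma htriangle_with_cos_exists:
  fixes b c t :: real
  assumes "b > 0" "c > 0" "-1 < t" "t < 1"
  obtains A B C where "htriangle A B C" "hdist A C = b" "hdist A B = c" "cos (hangle B A C) = t"
proof -
  let ?k = "tanh (b / 2) * tanh (c / 2)"
  define z w where "z = complex_of_real (tanh (c / 2))" and "w = tanh (b / 2) *\<^sub>R cis (arccos t)"
  have n: "norm z = tanh (c / 2)" "norm w = tanh (b / 2)" using assms by (simp_all add: z_def w_def)
  then have h: "z \<in> hplane" "w \<in> hplane" by (simp_all add: tanh_real_lt_1)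
  have k: "?k > 0" using assms by simp
  have u: "cnj z * w = ?k *\<^sub>R cis (arccos t)" by (simp add: z_def w_def scaleR_conv_of_real)
  have "sin (arccos t) > 0" using assms arccos_lt_bounded[of t] by (intro sin_gt_zero) auto
  then have tri: "htriangle 0 z w" using h u k by (intro htriangle_at_0) auto
  have d: "hdist 0 w = b" "hdist 0 z = c" using h n hdist_0_eqI by blast+
  have "0 \<noteq> z" "0 \<noteq> w" using n assms by auto
  then have "?k * cos (hangle z 0 w) = Re (cnj z * w)"
    by (rule harea_polar[OF tri]) (simp add: d moebius_def)
  then have "cos (hangle z 0 w) = t" unfolding u using k assms by (simp add: cos_arccos)
  then show ?thesis using that tri d by blast
qed

section \<open>Sides, midpoints and circumscribed circles\<close>

text \<open>
  The hyperbolic substitute of Pythagoras: with \<open>A\<close> at the centre, both sides have the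
  common denominator \<open>(1 - (norm z)\<^sup>2) * (1 - (norm w)\<^sup>2)\<close>, and the numerators differ only in
  \<open>Re (cnj z * w)\<close> against \<open>(norm z)\<^sup>2 * (norm w)\<^sup>2\<close>.
\<close>
lemma sinh_sides_iff:
  assumes "A \<in> hplane" "B \<in> hplane" "C \<in> hplane"
  shows "(sinh (hdist B C / 2))\<^sup>2 = (sinh (hdist A C / 2))\<^sup>2 + (sinh (hdist A B / 2))\<^sup>2
    \<longleftrightarrow> Re (cnj (moebius A B) * moebius A C) = (tanh (hdist A C / 2) * tanh (hdist A B / 2))\<^sup>2"
proof -
  let ?z = "moebius A B" and ?w = "moebius A C"
  let ?Z = "(norm ?z)\<^sup>2" and ?W = "(norm ?w)\<^sup>2"
  have zw: "?z \<in> hplane" "?w \<in> hplane" using assms moebius_in by blast+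
  then have n: "1 - ?Z > 0" "1 - ?W > 0" by (auto simp: abs_square_less_1)
  have "(norm (?z - ?w))\<^sup>2 = (norm ?z)\<^sup>2 + (norm ?w)\<^sup>2 - 2 * Re (cnj ?z * ?w)"
    by (simp add: cmod_power2) (simp add: power2_eq_square algebra_simps)
  then have a: "(sinh (hdist B C / 2))\<^sup>2 = (?Z + ?W - 2 * Re (cnj ?z * ?w)) / ((1 - ?Z) * (1 - ?W))"
    using sinh_half_hdist[OF zw] unfolding sides_from_moebius(3)[OF assms] by simp
  have "(sinh (hdist A C / 2))\<^sup>2 = ?W / (1 - ?W)" "(sinh (hdist A B / 2))\<^sup>2 = ?Z / (1 - ?Z)"
    using sinh_half_hdist[of 0] zw unfolding sides_from_moebius(1,2)[OF assms] by simp_all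
  then have bc: "(sinh (hdist A C / 2))\<^sup>2 + (sinh (hdist A B / 2))\<^sup>2 =
      (?Z + ?W - 2 * (?Z * ?W)) / ((1 - ?Z) * (1 - ?W))"
    using n by (simp add: add_frac_eq) (simp add: algebra_simps)
  have k: "(tanh (hdist A C / 2) * tanh (hdist A B / 2))\<^sup>2 = ?Z * ?W"
    using assms by (simp add: norm_moebius_tanh power_mult_distrib del: mem_ball)
  show ?thesis unfolding a bc k using n by auto
qed

text \<open>
  With the midpoint at the centre, the end points have equal modulus \<open>r\<close> and are at the distance that
  the diameter of radius \<open>r\<close> has, which forces their Euclidean distance to be \<open>2 * r\<close>.
\<close>
lemma hmidpoint_antipodal:
  assumes "M \<in> hplane" "B \<in> hplane" "C \<in> hplane" "hmidpoint M B C"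
  shows "moebius M C = - moebius M B"
proof -
  let ?B = "moebius M B" and ?C = "moebius M C" and ?d = "hdist M B"
  have h: "?B \<in> hplane" "?C \<in> hplane" using assms moebius_in by blast+
  have d: "hdist M C = ?d" "hdist B C = 2 * ?d"
    using assms(4) hdist_commute[of B M] by (auto simp: hmidpoint_def hsegment_def)
  let ?r = "norm ?B"
  have r: "norm ?C = ?r" using d(1) assms by (simp add: norm_moebius_tanh del: mem_ball)
  have r1: "1 - ?r\<^sup>2 > 0" using h by (simp add: abs_square_less_1)
  have "(sinh (?d / 2))\<^sup>2 = ?r\<^sup>2 / (1 - ?r\<^sup>2)"
    unfolding sides_from_moebius(1)[OF assms(1-3)] using h sinh_half_hdist[of 0 ?B] by (simp del: mem_ball)
  moreover have "(sinh ?d)\<^sup>2 = (norm (?B - ?C))\<^sup>2 / (1 - ?r\<^sup>2)\<^sup>2"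
    using sinh_half_hdist[OF h] d(2) unfolding sides_from_moebius(3)[OF assms(1-3)] r
    by (simp add: power2_eq_square)
  moreover have "(sinh ?d)\<^sup>2 = 4 * (sinh (?d / 2))\<^sup>2 * (1 + (sinh (?d / 2))\<^sup>2)"
    using sinh_double[of "?d / 2"] cosh_square_eq[of "?d / 2"] by (simp add: power_mult_distrib add.commute)
  ultimately have "(norm (?B - ?C))\<^sup>2 / (1 - ?r\<^sup>2)\<^sup>2 = 4 * (?r\<^sup>2 / (1 - ?r\<^sup>2)) * (1 + ?r\<^sup>2 / (1 - ?r\<^sup>2))"
    by simp
  moreover have "1 + ?r\<^sup>2 / (1 - ?r\<^sup>2) = 1 / (1 - ?r\<^sup>2)" using r1 by (simp add: field_simps)
  ultimately have "(norm (?B - ?C))\<^sup>2 / (1 - ?r\<^sup>2)\<^sup>2 = 4 * ?r\<^sup>2 / (1 - ?r\<^sup>2)\<^sup>2"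
    by (simp add: power2_eq_square)
  then have "(norm (?B - ?C))\<^sup>2 = 4 * ?r\<^sup>2" using r1 by simp
  moreover have "(norm (?B + ?C))\<^sup>2 + (norm (?B - ?C))\<^sup>2 = 2 * (norm ?B)\<^sup>2 + 2 * (norm ?C)\<^sup>2"
    by (simp add: cmod_power2) (simp add: power2_eq_square algebra_simps)
  ultimately have "?B + ?C = 0" unfolding r by simp
  then show ?thesis by (simp add: add_eq_0_iff)
qed

text \<open>
  With \<open>B\<close> moved to the centre the segment becomes a Euclidean radius, on which the midpoint is
  found by its modulus.
\<close>
lemma hmidpoint_exists:
  assumes "B \<in> hplane" "C \<in> hplane"
  obtains M where "M \<in> hplane" "hmidpoint M B C"
proof -
  let ?D = "moebius B C"
  have D: "?D \<in> hplane" using assms moebius_in by blast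
  \<comment> \<open>\<open>4 * x\<close> is the distance from \<open>B\<close> to \<open>C\<close>; a point at distance \<open>2 * x\<close> from \<open>0\<close> has modulus \<open>tanh x\<close>.\<close>
  define x where "x = hdist 0 ?D / 4"
  have x: "x \<ge> 0" using hdist_nonneg[of 0 ?D] D by (simp add: x_def)
  have nD: "norm ?D = tanh (2 * x)" using tanh_hdist_0[OF D] by (simp add: x_def)
  define N where "N = tanh x *\<^sub>R sgn ?D"
  have nN: "norm N = tanh (hdist 0 ?D / 2 / 2)"
    using x by (cases "?D = 0") (auto simp: N_def norm_sgn x_def hdist_def)
  have N: "N \<in> hplane" unfolding mem_ball_0 nN by (rule tanh_real_lt_1)
  have N2: "hdist 0 N = hdist 0 ?D / 2" by (rule hdist_0_eqI[OF N nN])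
  have "N \<in> closed_segment 0 ?D"
  proof (cases "?D = 0")
    case False
    have "tanh x \<le> norm ?D" unfolding nD using x by simp
    then have "0 \<le> tanh x / norm ?D" "tanh x / norm ?D \<le> 1" using x False by (auto simp: divide_le_eq)
    moreover have "N = (tanh x / norm ?D) *\<^sub>R ?D" by (simp add: N_def sgn_div_norm divide_inverse)
    ultimately show ?thesis unfolding in_segment by auto
  qed (simp add: N_def)
  then have N3: "hdist 0 N + hdist N ?D = hdist 0 ?D" using hsegment_0_iff[OF N D] by simp
  define M where "M = moebius (- B) N"
  have M: "M \<in> hplane" unfolding M_def using assms N by (intro moebius_in) auto
  have d: "1 + cnj B * N \<noteq> 0" "1 - cnj B * B \<noteq> 0"
    using hdist_denom_nz[of "- B" N] hdist_denom_nz[of B B] assms N by auto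
  have "M = (N + B) / (1 + cnj B * N)" by (simp add: M_def moebius_def)
  then have "moebius B M = N" unfolding moebius_def[of B M]
    using moebius_inverse_diff[OF d(1), of B] moebius_inverse_denom[OF d(1), of B] divide_divide_cancel[OF d] by metis
  then have "hdist B M = hdist 0 N" "hdist M C = hdist N ?D" "hdist B C = hdist 0 ?D"
    using sides_from_moebius[OF assms(1) M assms(2)] by auto
  then have "hmidpoint M B C" using N2 N3 M by (auto simp: hmidpoint_def hsegment_def)
  then show ?thesis using that M by blast
qed

text \<open>
  With the midpoint \<open>M\<close> at the centre, \<open>B\<close> and \<open>C\<close> are opposite points, and the parallelogram identity
  evaluates the sum of the two squares; it depends on \<open>A\<close> only through its modulus.
\<close>
lemma median_iff:
  assumes "A \<in> hplane" "B \<in> hplane" "C \<in> hplane" "M \<in> hplane" "hmidpoint M B C"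
  shows "hdist M A = hdist M B \<longleftrightarrow>
    (sinh (hdist B C / 2))\<^sup>2 = (sinh (hdist A C / 2))\<^sup>2 + (sinh (hdist A B / 2))\<^sup>2"
proof -
  let ?A = "moebius M A" and ?B = "moebius M B"
  let ?x = "(norm ?A)\<^sup>2" and ?y = "(norm ?B)\<^sup>2"
  have C: "moebius M C = - ?B" using hmidpoint_antipodal assms by blast
  have h: "?A \<in> hplane" "?B \<in> hplane" "- ?B \<in> hplane"
    using assms moebius_in[of M] by auto
  have n: "1 - ?x > 0" "1 - ?y > 0" using h by (auto simp: abs_square_less_1)
  have "(norm (?A + ?B))\<^sup>2 + (norm (?A - ?B))\<^sup>2 = 2 * ?x + 2 * ?y"
    by (simp add: cmod_power2) (simp add: power2_eq_square algebra_simps)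
  then have "(sinh (hdist A C / 2))\<^sup>2 + (sinh (hdist A B / 2))\<^sup>2 = 2 * (?x + ?y) / ((1 - ?x) * (1 - ?y))"
    using h sides_from_moebius(3)[of M A C] sides_from_moebius(3)[of M A B] assms
    by (simp add: C sinh_half_hdist add_divide_distrib[symmetric] del: mem_ball)
  moreover have "(sinh (hdist B C / 2))\<^sup>2 = 4 * ?y / ((1 - ?y) * (1 - ?y))"
    using h sides_from_moebius(3)[of M B C] assms
    by (simp add: C sinh_half_hdist norm_mult power_mult_distrib flip: mult_2 del: mem_ball)
  moreover have "4 * y / ((1 - y) * (1 - y)) = 2 * (x + y) / ((1 - x) * (1 - y)) \<longleftrightarrow> x = y"
    if "1 - x > 0" "1 - y > 0" "y \<ge> 0" for x y :: real
  proof -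
    have "4 * y / ((1 - y) * (1 - y)) = 2 * (x + y) / ((1 - x) * (1 - y)) \<longleftrightarrow>
        4 * y * ((1 - x) * (1 - y)) = 2 * (x + y) * ((1 - y) * (1 - y))"
      using that by (intro frac_eq_eq) auto
    also have "\<dots> \<longleftrightarrow> (y - x) * (1 + y) * (2 * (1 - y)) = 0"
      by (simp only: right_minus_eq[symmetric, of "4 * y * ((1 - x) * (1 - y))"]) (simp add: algebra_simps)
    also have "\<dots> \<longleftrightarrow> x = y" using that by auto
    finally show ?thesis .
  qed
  from this[OF n] have "4 * ?y / ((1 - ?y) * (1 - ?y)) = 2 * (?x + ?y) / ((1 - ?x) * (1 - ?y)) \<longleftrightarrow> ?x = ?y"
    by simp
  moreover have "?x = ?y \<longleftrightarrow> hdist M A = hdist M B"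
  proof -
    have "?x = ?y \<longleftrightarrow> norm ?A = norm ?B" by simp
    also have "\<dots> \<longleftrightarrow> tanh (hdist M A / 2) = tanh (hdist M B / 2)"
      using assms by (simp only: norm_moebius_tanh)
    also have "\<dots> \<longleftrightarrow> hdist M A = hdist M B"
      using strict_mono_eq[OF tanh_real_strict_mono, of "hdist M A / 2" "hdist M B / 2"] by simp
    finally show ?thesis .
  qed
  ultimately show ?thesis by simp
qed

text \<open>
  The midpoint of \<open>BC\<close> is equidistant from \<open>B\<close> and \<open>C\<close> anyway, so the circle exists exactly if the median
  from \<open>A\<close> is as long as half of \<open>BC\<close>.
\<close>
lemma circumscribed_midpoint_iff:
  assumes "A \<in> hplane" "B \<in> hplane" "C \<in> hplane" "A \<noteq> B"
  shows "(\<exists>p r. hcircumscribed p r A B C \<and> hmidpoint p B C) \<longleftrightarrow>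
    (sinh (hdist B C / 2))\<^sup>2 = (sinh (hdist A C / 2))\<^sup>2 + (sinh (hdist A B / 2))\<^sup>2" (is "?L \<longleftrightarrow> ?R")
proof
  assume ?L
  then obtain p where "p \<in> hplane" "hmidpoint p B C" "hdist p A = hdist p B"
    by (auto simp: hcircumscribed_def hcircle_def)
  then show ?R using median_iff assms by blast
next
  assume ?R
  obtain M where M: "M \<in> hplane" "hmidpoint M B C" using hmidpoint_exists assms by blast
  then have e: "hdist M A = hdist M B" "hdist M C = hdist M B"
    using median_iff[OF assms(1-3) M] \<open>?R\<close> hdist_commute[of B M] by (auto simp: hmidpoint_def)
  have "hdist M B > 0"
    using hdist_pos[of M B] hdist_pos[of M A] M(1) assms e(1) by (cases "M = B") auto
  then have "hcircumscribed M (hdist M B) A B C"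
    using assms M(1) e by (simp add: hcircumscribed_def hcircle_def)
  then show ?L using M(2) by blast
qed

section \<open>The equivalence\<close>

theorem theorem2:
  fixes a b c \<alpha> \<beta> \<gamma> S :: real and A B C :: complex
  assumes "b > 0" and "c > 0"
    and "htriangle A B C"
    and "hdist A C = b" and "hdist A B = c" and "a = hdist B C"
    and "\<alpha> = hangle B A C" and "\<beta> = hangle A B C" and "\<gamma> = hangle A C B"
    and "S = harea A B C"
  defines "cond0 \<equiv> (\<forall>A' B' C'. htriangle A' B' C' \<and> hdist A' C' = b \<and> hdist A' B' = c
                       \<longrightarrow> harea A' B' C' \<le> S)"
    and "cond1 \<equiv> (\<alpha> = \<beta> + \<gamma> \<and> \<beta> + \<gamma> < pi / 2)"
    and "cond2 \<equiv> (\<exists>p r. hcircumscribed p r A B C \<and> hmidpoint p B C)"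
    and "cond3 \<equiv> (sin (S / 2) = tanh (b / 2) * tanh (c / 2))"
    and "cond4 \<equiv> (cos \<alpha> = tanh (b / 2) * tanh (c / 2))"
    and "cond5 \<equiv> ((sinh (a / 2))\<^sup>2 = (sinh (b / 2))\<^sup>2 + (sinh (c / 2))\<^sup>2)"
  shows "(cond0 \<longleftrightarrow> cond1) \<and> (cond1 \<longleftrightarrow> cond2) \<and> (cond2 \<longleftrightarrow> cond3) \<and>
         (cond3 \<longleftrightarrow> cond4) \<and> (cond4 \<longleftrightarrow> cond5)"
proof -
  let ?k = "tanh (b / 2) * tanh (c / 2)"
  have k: "0 < ?k" "?k < 1"
  proof -
    show "0 < ?k" using assms(1,2) by simp
    have "?k < 1 * 1" using assms(1,2) by (intro mult_strict_mono) (auto simp: tanh_real_lt_1)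
    then show "?k < 1" by simp
  qed
  have trig: "sin (harea A' B' C' / 2) \<le> ?k"
      "sin (harea A' B' C' / 2) = ?k \<longleftrightarrow> cos (hangle B' A' C') = ?k"
      "harea A' B' C' / 2 = pi / 2 - hangle B' A' C' \<longleftrightarrow> cos (hangle B' A' C') = ?k"
      "0 < harea A' B' C'" "harea A' B' C' < pi"
      "?k * cos (hangle B' A' C') = Re (cnj (moebius A' B') * moebius A' C')"
    if tri: "htriangle A' B' C'" and sides: "hdist A' C' = b" "hdist A' B' = c" for A' B' C'
  proof -
    have ne: "A' \<noteq> B'" "A' \<noteq> C'" using sides assms(1,2) by (auto simp: hdist_def)
    obtain R where R: "R > 0" "R * cos (harea A' B' C' / 2) = 1 - ?k * cos (hangle B' A' C')"
      "R * sin (harea A' B' C' / 2) = ?k * sin (hangle B' A' C')"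
      "0 < harea A' B' C'" "harea A' B' C' < pi" "0 < hangle B' A' C'" "hangle B' A' C' < pi"
      "?k * cos (hangle B' A' C') = Re (cnj (moebius A' B') * moebius A' C')"
      using harea_polar[OF tri ne] unfolding sides by blast
    then show "0 < harea A' B' C'" "harea A' B' C' < pi"
      "?k * cos (hangle B' A' C') = Re (cnj (moebius A' B') * moebius A' C')" by auto
    show "sin (harea A' B' C' / 2) \<le> ?k"
      "sin (harea A' B' C' / 2) = ?k \<longleftrightarrow> cos (hangle B' A' C') = ?k"
      "harea A' B' C' / 2 = pi / 2 - hangle B' A' C' \<longleftrightarrow> cos (hangle B' A' C') = ?k"
      using half_area_trig[of R "harea A' B' C' / 2" ?k "hangle B' A' C'"] R k by auto
  qed
  note ABC = trig[OF assms(3-5), folded assms(7,10)]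
  have sin_mono: "x \<le> y \<longleftrightarrow> sin (x / 2) \<le> sin (y / 2)" if "0 < x" "x < pi" "0 < y" "y < pi" for x y
    using that sin_mono_le_eq[of "x / 2" "y / 2"] by auto
  have h: "A \<in> hplane" "B \<in> hplane" "C \<in> hplane" using assms(3) by (auto simp: htriangle_def)
  have ne: "A \<noteq> B" using assms(2,5) by (auto simp: hdist_def)
  have "cond3 \<longleftrightarrow> cond4" unfolding cond3_def cond4_def by (rule ABC(2))
  moreover have "cond1 \<longleftrightarrow> cond4"
  proof -
    have S: "S = pi - \<alpha> - \<beta> - \<gamma>" by (simp add: assms(7-10) harea_def)
    then have "cond1 \<longleftrightarrow> S / 2 = pi / 2 - \<alpha>" unfolding cond1_def using ABC(4) by auto
    then show ?thesis using ABC(3) by (simp add: cond4_def)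
  qed
  moreover have "cond4 \<longleftrightarrow> cond5"
  proof -
    have "cond5 \<longleftrightarrow> ?k * cos \<alpha> = ?k\<^sup>2"
      using sinh_sides_iff[OF h] ABC(6) unfolding cond5_def assms(4-6) by simp
    then show ?thesis using assms(1,2) by (simp add: cond4_def power2_eq_square)
  qed
  moreover have "cond2 \<longleftrightarrow> cond5"
    using circumscribed_midpoint_iff[OF h ne] unfolding cond2_def cond5_def assms(4-6) .
  moreover have "cond0 \<longleftrightarrow> cond3"
  proof
    assume max: cond0
    \<comment> \<open>A triangle attaining the bound exists, so a maximal one attains it too.\<close>
    obtain A' B' C' where tri: "htriangle A' B' C'" "hdist A' C' = b" "hdist A' B' = c" "cos (hangle B' A' C') = ?k"
      using htriangle_with_cos_exists[of b c ?k] assms(1,2) k by auto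
    note A'B'C' = trig[OF tri(1-3)]
    have "harea A' B' C' \<le> S" using max tri unfolding cond0_def by blast
    then have "?k \<le> sin (S / 2)" using A'B'C' tri(4) sin_mono ABC by metis
    then show cond3 using ABC(1) by (simp add: cond3_def)
  next
    assume cond3
    then show cond0 unfolding cond0_def cond3_def using trig(1,4,5) sin_mono ABC by metis
  qed
  ultimately show ?thesis by blast
qed

end
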